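(* Let $n$ be a positive integer and let $d>1$ be a divisor of $n$; put $\lambda=n/d$. Let $\sigma$ be the cycle $(2\,3\,\cdots\,d)$ in the symmetric group on $\{1,\dots,d\}$, and for $0\le i\le d-2$ let $P_i$ be the $d\times d$ permutation matrix of $\sigma^i$. Let $F_i$ be the $n\times n$ matrix obtained from $P_i$ by replacing each entry $0$ by a $\lambda\times\lambda$ block of zeros and each entry $1$ by a $\lambda\times\lambda$ block of ones. Then $\{F_0,\dots,F_{d-2}\}$ is a set of $d-1$ mutually orthogonal binary frequency squares of type $(n;n-\lambda,\lambda)$, and if there is a prime $p$ dividing $d$ that does not divide $\lambda$, then this set is type-maximal.
   Context: A frequency square of type $(n;\lambda_0,\dots,\lambda_{m-1})$ (with $m\ge 2$, all $\lambda_i\ge1$, $\sum\lambda_i=n$) is an $n\times n$ array on symbols $\{0,\dots,m-1\}$ in which symbol $i$ occurs exactly $\lambda_i$ times in each row and each column. It is binary if $m=2$. Two frequency squares $F,F'$ of types $(n;\lambda_0,\dots,\lambda_{m_1-1})$ and $(n;\mu_0,\dots,\mu_{m_2-1})$ are orthogonal if, when superimposed, each ordered pair $(i,j)$ occurs in exactly $\lambda_i\mu_j$ cells. A set of mutually orthogonal frequency squares (MOFS) is a set of frequency squares that are pairwise orthogonal. A set $\{F_1,\dots,F_k\}$ of MOFS is type-maximal if there is no frequency square $F$ that is orthogonal to every $F_i$ and has the same type as some $F_t$. *)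

theory Defs
  imports
    "HOL-Computational_Algebra.Primes"
    "HOL-Combinatorics.Cycles"
    "Jordan_Normal_Form.Matrix"
begin

text \<open>
  The type \<open>(n; \<lambda>\<^sub>0, \<dots>, \<lambda>\<^sub>m\<^sub>-\<^sub>1)\<close> is given by \<open>n\<close> and the list \<open>[\<lambda>\<^sub>0, \<dots>, \<lambda>\<^sub>m\<^sub>-\<^sub>1]\<close>; a square is
  binary when this list has length 2.
\<close>

definition frequency_type :: "nat \<Rightarrow> nat list \<Rightarrow> bool" where
  "frequency_type n ls \<longleftrightarrow>
     length ls \<ge> 2 \<and> (\<forall>l \<in> set ls. l \<ge> 1) \<and> sum_list ls = n"

definition frequency_square :: "nat \<Rightarrow> nat list \<Rightarrow> nat mat \<Rightarrow> bool" where
  "frequency_square n ls F \<longleftrightarrow>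
     frequency_type n ls \<and>
     F \<in> carrier_mat n n \<and>
     (\<forall>r < n. \<forall>c < n. F $$ (r, c) < length ls) \<and>
     (\<forall>i < length ls. \<forall>r < n. card {c. c < n \<and> F $$ (r, c) = i} = ls ! i) \<and>
     (\<forall>i < length ls. \<forall>c < n. card {r. r < n \<and> F $$ (r, c) = i} = ls ! i)"

definition orthogonal_squares :: "nat \<Rightarrow> nat mat \<Rightarrow> nat mat \<Rightarrow> bool" where
  "orthogonal_squares n F G \<longleftrightarrow>
     (\<exists>ls ms. frequency_square n ls F \<and> frequency_square n ms G \<and>
        (\<forall>i < length ls. \<forall>j < length ms.
           card {(r, c). r < n \<and> c < n \<and> F $$ (r, c) = i \<and> G $$ (r, c) = j} = ls ! i * ms ! j))"

definition mofs :: "nat \<Rightarrow> nat mat set \<Rightarrow> bool" where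
  "mofs n S \<longleftrightarrow>
     (\<forall>F \<in> S. \<exists>ls. frequency_square n ls F) \<and>
     (\<forall>F \<in> S. \<forall>G \<in> S. F \<noteq> G \<longrightarrow> orthogonal_squares n F G)"

definition type_maximal :: "nat \<Rightarrow> nat mat set \<Rightarrow> bool" where
  "type_maximal n S \<longleftrightarrow>
     mofs n S \<and>
     \<not> (\<exists>F. (\<forall>G \<in> S. orthogonal_squares n F G) \<and>
            (\<exists>T \<in> S. \<exists>ls. frequency_square n ls T \<and> frequency_square n ls F))"

text \<open>
  Permutations act on \<open>{1, \<dots>, d}\<close> whereas matrix indices start at 0, hence the shift by \<open>Suc\<close>.
\<close>

definition perm_matrix :: "nat \<Rightarrow> (nat \<Rightarrow> nat) \<Rightarrow> nat mat" where
  "perm_matrix d \<pi> = mat d d (\<lambda>(r, c). if \<pi> (Suc r) = Suc c then 1 else 0)"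

text \<open>Replaces each entry \<open>x\<close> of \<open>A\<close> by the constant \<open>k \<times> k\<close> block with entries \<open>x\<close>.\<close>

definition inflate :: "nat \<Rightarrow> nat mat \<Rightarrow> nat mat" where
  "inflate k A =
     mat (dim_row A * k) (dim_col A * k) (\<lambda>(r, c). A $$ (r div k, c div k))"

definition sigma_cycle :: "nat \<Rightarrow> nat \<Rightarrow> nat" where
  "sigma_cycle d = cycle_of_list [2..<Suc d]"

definition cyclic_square :: "nat \<Rightarrow> nat \<Rightarrow> nat \<Rightarrow> nat mat" where
  "cyclic_square d k i = inflate k (perm_matrix d (sigma_cycle d ^^ i))"

end

theory Submission
  imports Defs
begin

text \<open>
  Every \<open>F\<^sub>i\<close> has ones in the whole top-left block, and every cell outside the first block row and
  the first block column is a one of exactly one \<open>F\<^sub>i\<close>. Hence the number \<open>w(r, c)\<close> of indices \<open>i\<close>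
  for which \<open>(r, c)\<close> is a one of \<open>F\<^sub>i\<close> satisfies
  \<open>w(r, c) + [r < \<lambda>] + [c < \<lambda>] = 1 + d [r < \<lambda> \<and> c < \<lambda>]\<close>.
  If \<open>F\<close> of the same type is orthogonal to all \<open>F\<^sub>i\<close>, summing this identity over the ones of \<open>F\<close> gives
  \<open>(d - 1) \<lambda>\<^sup>2 + \<lambda>\<^sup>2 + \<lambda>\<^sup>2 = d \<lambda>\<^sup>2 + d b\<close>, where \<open>b\<close> is the number of ones of \<open>F\<close> in the top-left
  block. So \<open>d\<close> divides \<open>\<lambda>\<^sup>2\<close>, and every prime divisor of \<open>d\<close> divides \<open>\<lambda>\<close>.
\<close>

section \<open>Frequency squares\<close>

lemma frequency_type_pos: "frequency_type n ls \<Longrightarrow> n > 0"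
  unfolding frequency_type_def by (cases ls) auto

text \<open>If \<open>ms\<close> were longer, symbol \<open>length ls\<close> would occur in row 0
  by the type \<open>ms\<close>, whose entries are positive, but it is no admissible entry for the
  type \<open>ls\<close>.\<close>

lemma frequency_square_length_le:
  assumes F: "frequency_square n ls F" and G: "frequency_square n ms F"
  shows "length ms \<le> length ls"
proof (rule ccontr)
  assume less: "\<not> length ms \<le> length ls"
  have n: "n > 0"
    using F frequency_type_pos unfolding frequency_square_def by blast
  have "card {c. c < n \<and> F $$ (0, c) = length ls} = ms ! length ls"
    using G less n unfolding frequency_square_def by auto
  moreover have "ms ! length ls \<ge> 1"
    using G less unfolding frequency_square_def frequency_type_def by auto
  moreover have "F $$ (0, c) \<noteq> length ls" if "c < n" for c
    using F n that unfolding frequency_square_def by (metis nat_neq_iff)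
  then have "{c. c < n \<and> F $$ (0, c) = length ls} = {}" by blast
  ultimately show False by simp
qed

text \<open>The counts in row 0 determine the type. This pins down the type lists that
  \<open>orthogonal_squares\<close> and \<open>type_maximal\<close> only assert to exist.\<close>

lemma frequency_square_type_unique:
  assumes F: "frequency_square n ls F" and G: "frequency_square n ms F"
  shows "ls = ms"
proof (rule nth_equalityI)
  show len: "length ls = length ms"
    using frequency_square_length_le[OF F G] frequency_square_length_le[OF G F] by simp
  have n: "n > 0"
    using F frequency_type_pos unfolding frequency_square_def by blast
  fix i assume "i < length ls"
  then have "card {c. c < n \<and> F $$ (0, c) = i} = ls ! i"
    "card {c. c < n \<and> F $$ (0, c) = i} = ms ! i"
    using F G n len unfolding frequency_square_def by auto
  then show "ls ! i = ms ! i" by simp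
qed

section \<open>Binary squares and their sets of ones\<close>

definition ones :: "nat \<Rightarrow> nat mat \<Rightarrow> (nat \<times> nat) set" where
  "ones n F = {(r, c). r < n \<and> c < n \<and> F $$ (r, c) = 1}"

lemma finite_ones [simp]: "finite (ones n F)"
  by (rule finite_subset[of _ "{..<n} \<times> {..<n}"]) (auto simp: ones_def)

lemma card_ones_rows:
  assumes F: "frequency_square n [n - a, a] F" and "m \<le> n"
  shows "card {x \<in> ones n F. fst x < m} = m * a"
proof -
  have "{x \<in> ones n F. fst x < m} = (SIGMA r:{..<m}. {c. c < n \<and> F $$ (r, c) = 1})"
    using \<open>m \<le> n\<close> by (auto simp: ones_def)
  moreover have "card {c. c < n \<and> F $$ (r, c) = 1} = a" if "r < m" for r
    using F that \<open>m \<le> n\<close> unfolding frequency_square_def by (force simp: less_Suc_eq)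
  ultimately show ?thesis by simp
qed

lemma card_ones_cols:
  assumes F: "frequency_square n [n - a, a] F" and "m \<le> n"
  shows "card {x \<in> ones n F. snd x < m} = m * a"
proof -
  \<comment> \<open>The swap makes the column the outer index of the dependent product.\<close>
  have "{x \<in> ones n F. snd x < m}
      = prod.swap ` (SIGMA c:{..<m}. {r. r < n \<and> F $$ (r, c) = 1})"
    using \<open>m \<le> n\<close> by (auto simp: ones_def image_iff)
  moreover have "card {r. r < n \<and> F $$ (r, c) = 1} = a" if "c < m" for c
    using F that \<open>m \<le> n\<close> unfolding frequency_square_def by (force simp: less_Suc_eq)
  ultimately show ?thesis by (simp add: card_image)
qed

lemma card_ones:
  assumes "frequency_square n [n - a, a] F"
  shows "card (ones n F) = n * a"
proof -
  have "{x \<in> ones n F. fst x < n} = ones n F" by (auto simp: ones_def)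
  then show ?thesis using card_ones_rows[OF assms order_refl] by simp
qed

text \<open>In a line with entries at most 1, the zeros are the complement of the ones, so it
  suffices to count ones.\<close>

lemma frequency_squareI_binary:
  assumes "1 \<le> a" "a < n" and F: "F \<in> carrier_mat n n"
    and le: "\<And>r c. r < n \<Longrightarrow> c < n \<Longrightarrow> F $$ (r, c) \<le> 1"
    and row: "\<And>r. r < n \<Longrightarrow> card {c. c < n \<and> F $$ (r, c) = 1} = a"
    and col: "\<And>c. c < n \<Longrightarrow> card {r. r < n \<and> F $$ (r, c) = 1} = a"
  shows "frequency_square n [n - a, a] F"
proof -
  have compl: "card {x. x < n \<and> f x = 0} = n - a"
    if "\<And>x. x < n \<Longrightarrow> f x \<le> 1" "card {x. x < n \<and> f x = 1} = a" for f :: "nat \<Rightarrow> nat"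
  proof -
    have "{x. x < n \<and> f x = 0} = {..<n} - {x. x < n \<and> f x = 1}"
      using that(1) by (auto simp: le_Suc_eq)
    then show ?thesis
      using that(2) by (simp add: card_Diff_subset subset_iff)
  qed
  have row0: "card {c. c < n \<and> F $$ (r, c) = 0} = n - a" if "r < n" for r
    using compl[of "\<lambda>c. F $$ (r, c)"] le row that by simp
  have col0: "card {r. r < n \<and> F $$ (r, c) = 0} = n - a" if "c < n" for c
    using compl[of "\<lambda>r. F $$ (r, c)"] le col that by simp
  show ?thesis
    unfolding frequency_square_def frequency_type_def
    using assms row0 col0 by (auto simp: less_Suc_eq le_Suc_eq)
qed

text \<open>The totals of ones in \<open>F\<close> and \<open>G\<close> being fixed, the count of
  the pair (1, 1) determines the counts of the other three pairs.\<close>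

lemma orthogonal_squaresI_binary:
  assumes F: "frequency_square n [n - a, a] F" and G: "frequency_square n [n - b, b] G"
    and inter: "card (ones n F \<inter> ones n G) = a * b"
  shows "orthogonal_squares n F G"
proof -
  let ?U = "{..<n} \<times> {..<n}" and ?A = "ones n F" and ?B = "ones n G"
  let ?N = "\<lambda>i j. {(r, c). r < n \<and> c < n \<and> F $$ (r, c) = i \<and> G $$ (r, c) = j}"
  have zF: "F $$ (r, c) \<noteq> Suc 0 \<longleftrightarrow> F $$ (r, c) = 0" if "r < n" "c < n" for r c
    using F that unfolding frequency_square_def by (force simp: less_Suc_eq)
  have zG: "G $$ (r, c) \<noteq> Suc 0 \<longleftrightarrow> G $$ (r, c) = 0" if "r < n" "c < n" for r c
    using G that unfolding frequency_square_def by (force simp: less_Suc_eq)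
  have cA: "card ?A = n * a" and cB: "card ?B = n * b"
    using card_ones F G by auto
  \<comment> \<open>Each set is a difference in which a subset is removed, so cardinalities
    subtract; for (0, 0) first \<open>?A\<close> is removed, then the rest of
    \<open>?B\<close>.\<close>
  have sets: "?N 1 1 = ?A \<inter> ?B" "?N 1 0 = ?A - ?A \<inter> ?B" "?N 0 1 = ?B - ?A \<inter> ?B"
    "?N 0 0 = (?U - ?A) - (?B - ?A \<inter> ?B)"
    using zF zG by (auto simp: ones_def)
  have n11: "card (?N 1 1) = a * b"
    unfolding sets by (rule inter)
  have n10: "card (?N 1 0) = a * (n - b)"
    unfolding sets
    by (subst card_Diff_subset) (auto simp: cA inter diff_mult_distrib2 mult.commute)
  have cBA: "card (?B - ?A \<inter> ?B) = (n - a) * b"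
    by (subst card_Diff_subset) (auto simp: cB inter diff_mult_distrib)
  then have n01: "card (?N 0 1) = (n - a) * b"
    unfolding sets .
  have "?A \<subseteq> ?U" by (auto simp: ones_def)
  then have "card (?U - ?A) = n * n - n * a"
    using cA by (simp add: card_Diff_subset)
  then have "card (?N 0 0) = (n * n - n * a) - (n - a) * b"
    unfolding sets
    by (subst card_Diff_subset) (use cBA in \<open>auto simp: ones_def intro: finite_Diff finite_ones[unfolded ones_def One_nat_def]\<close>)
  then have n00: "card (?N 0 0) = (n - a) * (n - b)"
    by (simp add: diff_mult_distrib diff_mult_distrib2 mult.commute)
  show ?thesis
    unfolding orthogonal_squares_def
    by (rule exI[of _ "[n - a, a]"], rule exI[of _ "[n - b, b]"])
      (use F G n11 n10 n01 n00 in \<open>auto simp: less_Suc_eq\<close>)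
qed

lemma orthogonal_squares_card_ones:
  assumes "orthogonal_squares n F G"
    and F: "frequency_square n [n - a, a] F" and G: "frequency_square n [n - b, b] G"
  shows "card (ones n F \<inter> ones n G) = a * b"
proof -
  obtain ls ms where ls: "frequency_square n ls F" and ms: "frequency_square n ms G"
    and card: "\<forall>i < length ls. \<forall>j < length ms.
      card {(r, c). r < n \<and> c < n \<and> F $$ (r, c) = i \<and> G $$ (r, c) = j} = ls ! i * ms ! j"
    using assms(1) unfolding orthogonal_squares_def by blast
  have types: "ls = [n - a, a]" "ms = [n - b, b]"
    using frequency_square_type_unique ls ms F G by blast+
  have "ones n F \<inter> ones n G
      = {(r, c). r < n \<and> c < n \<and> F $$ (r, c) = 1 \<and> G $$ (r, c) = 1}"
    by (auto simp: ones_def)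
  then show ?thesis
    using card[rule_format, of 1 1] by (simp add: types)
qed

section \<open>The powers of the cycle\<close>

text \<open>The permutation \<open>\<sigma>\<^sup>i\<close>, shifted to act on \<open>{0, \<dots>, d - 1}\<close>.\<close>

definition shift :: "nat \<Rightarrow> nat \<Rightarrow> nat \<Rightarrow> nat" where
  "shift d i a = (if a = 0 then 0 else Suc ((a - 1 + i) mod (d - 1)))"

text \<open>The point 1 is outside the cycle and stays fixed. On the cycle, the \<open>i\<close>-th
  power rotates the list by \<open>i\<close> places, and \<open>Suc a\<close> is its entry at
  position \<open>a - 1\<close>.\<close>

lemma sigma_cycle_funpow:
  assumes "a < d"
  shows "(sigma_cycle d ^^ i) (Suc a) = Suc (shift d i a)"
proof (cases "a = 0")
  case True
  have "sigma_cycle d (Suc 0) = Suc 0"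
    unfolding sigma_cycle_def by (rule id_outside_supp) auto
  then have "(sigma_cycle d ^^ i) (Suc 0) = Suc 0"
    by (induction i) auto
  then show ?thesis using True by (simp add: shift_def)
next
  case False
  let ?cs = "[2..<Suc d]"
  have rot: "map (sigma_cycle d ^^ i) ?cs = rotate i ?cs"
    unfolding sigma_cycle_def by (rule cyclic_rotation) simp
  have len: "length ?cs = d - 1" using assms False by (simp del: upt_Suc)
  have a: "a - 1 < length ?cs" using False assms by auto
  have "(sigma_cycle d ^^ i) (?cs ! (a - 1)) = map (sigma_cycle d ^^ i) ?cs ! (a - 1)"
    using a by (simp only: nth_map)
  also have "\<dots> = ?cs ! ((i + (a - 1)) mod (d - 1))"
    using a by (simp only: rot nth_rotate len)
  also have "\<dots> = 2 + (i + (a - 1)) mod (d - 1)"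
  proof (rule nth_upt)
    have "(i + (a - 1)) mod (d - 1) < d - 1" using assms False by (intro mod_less_divisor) simp
    then show "2 + (i + (a - 1)) mod (d - 1) < Suc d" by simp
  qed
  finally have "(sigma_cycle d ^^ i) (?cs ! (a - 1)) = 2 + (i + (a - 1)) mod (d - 1)" .
  moreover have "?cs ! (a - 1) = Suc a"
    using False assms by (subst nth_upt) auto
  ultimately show ?thesis using False by (simp add: shift_def add.commute)
qed

text \<open>Adding \<open>m - x\<close> undoes adding \<open>x\<close> modulo \<open>m\<close>, and
  all three numbers are reduced residues. It serves to solve for the exponent as well as for the
  preimage under \<open>shift\<close>.\<close>

lemma add_mod_eq_iff:
  fixes x y z m :: nat
  assumes "x < m" "y < m" "z < m"
  shows "(x + y) mod m = z \<longleftrightarrow> y = (z + (m - x)) mod m"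
proof
  assume "(x + y) mod m = z"
  then have "(z + (m - x)) mod m = ((x + y) mod m + (m - x)) mod m" by simp
  also have "\<dots> = (x + y + (m - x)) mod m" by (rule mod_add_left_eq)
  also have "x + y + (m - x) = y + m" using assms by simp
  finally show "y = (z + (m - x)) mod m" using assms by simp
next
  assume "y = (z + (m - x)) mod m"
  then have "(x + y) mod m = (x + (z + (m - x)) mod m) mod m" by simp
  also have "\<dots> = (x + (z + (m - x))) mod m" by (rule mod_add_right_eq)
  also have "x + (z + (m - x)) = z + m" using assms by simp
  finally show "(x + y) mod m = z" using assms by simp
qed

lemma shift_less:
  assumes "a < d"
  shows "shift d i a < d"
proof (cases "a = 0")
  case False
  then have "(a - 1 + i) mod (d - 1) < d - 1"
    using assms by (intro mod_less_divisor) simp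
  then have "Suc ((a - 1 + i) mod (d - 1)) < d"
    unfolding less_diff_conv Suc_eq_plus1 .
  then show ?thesis using False by (simp only: shift_def if_False)
qed (use assms in \<open>simp add: shift_def\<close>)

lemma shift_eq_0_iff [simp]: "shift d i a = 0 \<longleftrightarrow> a = 0"
  by (simp add: shift_def)

text \<open>The powers of the cycle act regularly on the nonzero indices: a single exponent below
  \<open>d - 1\<close> takes \<open>a\<close> to \<open>b\<close>.\<close>

lemma shift_index_eq_iff:
  assumes "0 < a" "a < d" "0 < b" "b < d" "i < d - 1"
  shows "shift d i a = b \<longleftrightarrow> i = (b - 1 + (d - 1 - (a - 1))) mod (d - 1)"
proof -
  have "shift d i a = b \<longleftrightarrow> (a - 1 + i) mod (d - 1) = b - 1"
    using assms(1,3) by (auto simp: shift_def)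
  also have "\<dots> \<longleftrightarrow> i = (b - 1 + (d - 1 - (a - 1))) mod (d - 1)"
    using assms by (intro add_mod_eq_iff) auto
  finally show ?thesis .
qed

lemma shift_index_inject:
  assumes "0 < a" "a < d" "i < d - 1" "j < d - 1" and eq: "shift d i a = shift d j a"
  shows "i = j"
proof -
  have b: "0 < shift d j a" "shift d j a < d"
    using assms(1) shift_less[OF assms(2)] by (auto intro: gr0I)
  show ?thesis
    using shift_index_eq_iff[OF assms(1,2) b assms(3), THEN iffD1, OF eq]
      shift_index_eq_iff[OF assms(1,2) b assms(4), THEN iffD1, OF refl] by (rule trans[OF _ sym])
qed

text \<open>Bijectivity of the shift, needed for the column counts; the witness is the shift
  backwards by \<open>i\<close>.\<close>

lemma shift_preimage:
  assumes "i < d - 1" "b < d"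
  obtains a' where "a' < d" "\<And>a. a < d \<Longrightarrow> shift d i a = b \<longleftrightarrow> a = a'"
proof (cases "b = 0")
  case True
  then show ?thesis using that[of 0] assms by simp
next
  case False
  let ?a = "Suc ((b - 1 + (d - 1 - i)) mod (d - 1))"
  have m: "(b - 1 + (d - 1 - i)) mod (d - 1) < d - 1"
    using assms by (intro mod_less_divisor) simp
  show ?thesis
  proof (rule that[of ?a])
    show "?a < d" using m by simp
    fix a assume "a < d"
    show "shift d i a = b \<longleftrightarrow> a = ?a"
    proof (cases "a = 0")
      case True
      then show ?thesis using False by (simp add: shift_def)
    next
      case a: False
      have "shift d i a = b \<longleftrightarrow> (i + (a - 1)) mod (d - 1) = b - 1"
        using a False by (auto simp: shift_def add.commute)
      also have "\<dots> \<longleftrightarrow> a - 1 = (b - 1 + (d - 1 - i)) mod (d - 1)"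
        using a False assms \<open>a < d\<close> by (intro add_mod_eq_iff) auto
      finally show ?thesis using a by auto
    qed
  qed
qed

text \<open>The weight identity at the level of blocks. All \<open>d - 1\<close> exponents fix 0,
  none takes 0 to a nonzero index or back, and exactly one joins two given nonzero indices.\<close>

lemma card_shift_index:
  assumes "a < d" "b < d"
  shows "card {i. i < d - 1 \<and> shift d i a = b} + of_bool (a = 0) + of_bool (b = 0)
    = 1 + d * of_bool (a = 0 \<and> b = 0)"
proof -
  consider "a = 0" "b = 0" | "a = 0" "b > 0" | "a > 0" "b = 0" | "a > 0" "b > 0" by auto
  then show ?thesis
  proof cases
    case 4
    let ?j = "(b - 1 + (d - 1 - (a - 1))) mod (d - 1)"
    have "?j < d - 1" using 4 assms by (intro mod_less_divisor) simp
    then have "{i. i < d - 1 \<and> shift d i a = b} = {?j}"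
      using shift_index_eq_iff[of a d b] 4 assms by auto
    then show ?thesis using 4 by simp
  qed (use assms in \<open>auto simp: shift_def\<close>)
qed

section \<open>The inflated permutation matrices\<close>

lemma card_div_eq:
  fixes k b d :: nat
  assumes "k > 0" "b < d"
  shows "card {x. x < d * k \<and> x div k = b} = k"
proof -
  have "{x. x < d * k \<and> x div k = b} = {b * k..<b * k + k}"
  proof (intro Set.set_eqI iffI)
    fix x assume "x \<in> {b * k..<b * k + k}"
    then have "x div k = b"
      by (intro div_nat_eqI) (auto simp: mult.commute)
    then show "x \<in> {x. x < d * k \<and> x div k = b}"
      using assms by (auto simp: div_less_iff_less_mult)
  next
    fix x assume "x \<in> {x. x < d * k \<and> x div k = b}"
    then show "x \<in> {b * k..<b * k + k}"
      using assms by (auto simp: div_times_less_eq_dividend dividend_less_div_times add.commute)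
  qed
  then show ?thesis by simp
qed

text \<open>Here \<open>k\<close> is \<lambda>, the order of the squares is \<open>d * k\<close>,
  and \<open>div k\<close> sends a row or column to its block.\<close>

locale cyclic_squares =
  fixes d k :: nat
  assumes d: "d > 1" and k: "k > 0"
begin

lemma cyclic_square_carrier: "cyclic_square d k i \<in> carrier_mat (d * k) (d * k)"
  by (simp add: cyclic_square_def inflate_def perm_matrix_def)

lemma div_less: "r < d * k \<Longrightarrow> r div k < d"
  using k by (simp add: div_less_iff_less_mult)

lemma cyclic_square_entry:
  assumes "r < d * k" "c < d * k"
  shows "cyclic_square d k i $$ (r, c) = (if shift d i (r div k) = c div k then 1 else 0)"
  using assms div_less
  by (simp add: cyclic_square_def inflate_def perm_matrix_def sigma_cycle_funpow)

lemma cyclic_square_eq_1_iff: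
  assumes "r < d * k" "c < d * k"
  shows "cyclic_square d k i $$ (r, c) = Suc 0 \<longleftrightarrow> shift d i (r div k) = c div k"
  using assms by (simp add: cyclic_square_entry del: One_nat_def)

lemma frequency_square_cyclic_square:
  assumes i: "i < d - 1"
  shows "frequency_square (d * k) [d * k - k, k] (cyclic_square d k i)"
proof (rule frequency_squareI_binary)
  show "1 \<le> k" "k < d * k" using d k by auto
  show "cyclic_square d k i \<in> carrier_mat (d * k) (d * k)" by (rule cyclic_square_carrier)
  show "cyclic_square d k i $$ (r, c) \<le> 1" if "r < d * k" "c < d * k" for r c
    using that by (simp add: cyclic_square_entry)
  show "card {c. c < d * k \<and> cyclic_square d k i $$ (r, c) = 1} = k" if r: "r < d * k" for r
  proof -
    have "{c. c < d * k \<and> cyclic_square d k i $$ (r, c) = 1}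
        = {c. c < d * k \<and> c div k = shift d i (r div k)}"
      using r by (auto simp: cyclic_square_eq_1_iff)
    then show ?thesis
      using card_div_eq[OF k] shift_less div_less[OF r] by simp
  qed
  show "card {r. r < d * k \<and> cyclic_square d k i $$ (r, c) = 1} = k" if c: "c < d * k" for c
  proof -
    obtain a' where a': "a' < d" "\<And>a. a < d \<Longrightarrow> shift d i a = c div k \<longleftrightarrow> a = a'"
      using shift_preimage[OF i div_less[OF c]] by blast
    have "{r. r < d * k \<and> cyclic_square d k i $$ (r, c) = 1} = {r. r < d * k \<and> r div k = a'}"
      using c a'(2) div_less by (auto simp: cyclic_square_eq_1_iff)
    then show ?thesis
      using card_div_eq[OF k a'(1)] by simp
  qed
qed

section \<open>Distinctness and orthogonality of the squares\<close>

lemma inj_on_cyclic_square: "inj_on (cyclic_square d k) {..<d - 1}"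
proof (rule inj_onI)
  fix i j assume ij: "i \<in> {..<d - 1}" "j \<in> {..<d - 1}"
    and eq: "cyclic_square d k i = cyclic_square d k j"
  let ?b = "shift d i 1"
  have b: "?b < d" "?b > 0" using shift_less[OF d] by (auto simp: shift_def)
  \<comment> \<open>Block row 0 is the same in all the squares, so the comparison uses block row 1;
    this cell is the first one of its block of ones.\<close>
  then have "cyclic_square d k i $$ (k, ?b * k) = 1"
    using k d by (simp add: cyclic_square_eq_1_iff)
  then have "cyclic_square d k j $$ (k, ?b * k) = 1" by (simp add: eq)
  then have "shift d j 1 = ?b"
    using k d b by (simp add: cyclic_square_eq_1_iff)
  then show "i = j"
    using shift_index_inject[of 1 d i j] d ij by simp
qed

text \<open>Distinct powers of the cycle agree only at the common fixed point, which inflates to the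
  top-left block. Its size \<open>k * k\<close> is what orthogonality demands.\<close>

lemma ones_inter_cyclic_squares:
  assumes "i < d - 1" "j < d - 1" "i \<noteq> j"
  shows "ones (d * k) (cyclic_square d k i) \<inter> ones (d * k) (cyclic_square d k j)
    = {..<k} \<times> {..<k}"
proof (intro Set.set_eqI iffI)
  fix x assume x: "x \<in> ones (d * k) (cyclic_square d k i) \<inter> ones (d * k) (cyclic_square d k j)"
  obtain r c where rc: "x = (r, c)" by (cases x)
  have less: "r < d * k" "c < d * k"
    using x by (auto simp: ones_def rc)
  have sh: "shift d i (r div k) = c div k" "shift d j (r div k) = c div k"
    using x less by (auto simp: ones_def rc cyclic_square_eq_1_iff)
  have "r div k = 0"
  proof (rule ccontr)
    assume "r div k \<noteq> 0"
    then show False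
      using shift_index_inject[of "r div k" d i j] sh assms div_less[OF less(1)] by simp
  qed
  moreover from this have "c div k = 0" using sh by (metis shift_eq_0_iff)
  ultimately show "x \<in> {..<k} \<times> {..<k}"
    using k by (simp add: rc div_eq_0_iff)
next
  fix x assume "x \<in> {..<k} \<times> {..<k}"
  moreover have "r < d * k" if "r < k" for r
    using that d by (metis less_le_trans mult_le_mono1 mult_1 less_imp_le)
  ultimately show "x \<in> ones (d * k) (cyclic_square d k i) \<inter> ones (d * k) (cyclic_square d k j)"
    by (auto simp: ones_def cyclic_square_entry shift_def)
qed

lemma orthogonal_cyclic_squares:
  assumes "i < d - 1" "j < d - 1" "i \<noteq> j"
  shows "orthogonal_squares (d * k) (cyclic_square d k i) (cyclic_square d k j)"
proof (rule orthogonal_squaresI_binary[where a = k and b = k])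
  show "frequency_square (d * k) [d * k - k, k] (cyclic_square d k i)"
    "frequency_square (d * k) [d * k - k, k] (cyclic_square d k j)"
    using assms frequency_square_cyclic_square by blast+
  show "card (ones (d * k) (cyclic_square d k i) \<inter> ones (d * k) (cyclic_square d k j)) = k * k"
    by (simp add: ones_inter_cyclic_squares[OF assms])
qed

section \<open>The divisibility obstruction to a further square\<close>

lemma orthogonal_cyclic_squares_imp_dvd:
  assumes F: "frequency_square (d * k) [d * k - k, k] F"
    and orth: "\<And>i. i < d - 1 \<Longrightarrow> orthogonal_squares (d * k) F (cyclic_square d k i)"
  shows "d dvd k * k"
proof -
  let ?n = "d * k"
  let ?A = "ones ?n F" and ?C = "\<lambda>i. ones ?n (cyclic_square d k i)"
  let ?b = "card {x \<in> ?A. fst x < k \<and> snd x < k}"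
  have kn: "k \<le> ?n" using d by simp
  have card_sum: "card {x \<in> ?A. P x} = (\<Sum>x\<in>?A. of_bool (P x))" for P
    by (simp add: sum_of_bool_eq Collect_conj_eq)
  \<comment> \<open>This carries \<open>card_shift_index\<close> over to cells: a row or column lies
    in block 0 exactly if its index is below \<open>k\<close>.\<close>
  have w: "card {i. i < d - 1 \<and> x \<in> ?C i} + of_bool (fst x < k) + of_bool (snd x < k)
      = 1 + d * of_bool (fst x < k \<and> snd x < k)" if "x \<in> ?A" for x
  proof -
    obtain r c where x: "x = (r, c)" by (cases x)
    have rc: "r < ?n" "c < ?n" using that by (auto simp: ones_def x)
    then have "{i. i < d - 1 \<and> x \<in> ?C i} = {i. i < d - 1 \<and> shift d i (r div k) = c div k}"
      by (auto simp: ones_def x cyclic_square_eq_1_iff)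
    then show ?thesis
      using card_shift_index[OF div_less[OF rc(1)] div_less[OF rc(2)]] k
      by (simp add: x div_eq_0_iff)
  qed
  \<comment> \<open>Double counting of the pairs of a one \<open>x\<close> of \<open>F\<close> and
    an index \<open>i\<close> with \<open>x\<close> also a one of the \<open>i\<close>-th
    square.\<close>
  have "(\<Sum>x\<in>?A. card {i. i < d - 1 \<and> x \<in> ?C i})
      = (\<Sum>x\<in>?A. \<Sum>i<d - 1. of_bool (x \<in> ?C i))"
    by (simp add: sum_of_bool_eq Collect_conj_eq lessThan_def)
  also have "\<dots> = (\<Sum>i<d - 1. \<Sum>x\<in>?A. of_bool (x \<in> ?C i))"
    by (rule sum.swap)
  also have "\<dots> = (\<Sum>i<d - 1. card (?A \<inter> ?C i))"
    by (simp flip: card_sum add: Int_def)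
  also have "\<dots> = (\<Sum>i<d - 1. k * k)"
    using orthogonal_squares_card_ones[OF orth F frequency_square_cyclic_square]
    by (intro sum.cong) auto
  finally have s1: "(\<Sum>x\<in>?A. card {i. i < d - 1 \<and> x \<in> ?C i}) = (d - 1) * (k * k)"
    by simp
  have s2: "(\<Sum>x\<in>?A. of_bool (fst x < k)) = k * k"
    using card_ones_rows[OF F kn] by (simp flip: card_sum)
  have s3: "(\<Sum>x\<in>?A. of_bool (snd x < k)) = k * k"
    using card_ones_cols[OF F kn] by (simp flip: card_sum)
  have s4: "(\<Sum>x\<in>?A. of_bool (fst x < k \<and> snd x < k)) = ?b"
    by (simp only: card_sum)
  have "(\<Sum>x\<in>?A. card {i. i < d - 1 \<and> x \<in> ?C i} + of_bool (fst x < k) + of_bool (snd x < k))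
      = (\<Sum>x\<in>?A. 1 + d * of_bool (fst x < k \<and> snd x < k))"
    by (intro sum.cong refl w)
  then have "(d - 1) * (k * k) + k * k + k * k = card ?A + d * ?b"
    by (simp only: sum.distrib s1 s2 s3 s4 sum_distrib_left[symmetric] sum_constant
        of_nat_id mult_1_right)
  \<comment> \<open>The total \<open>d * k * k\<close> is split so that it cancels against the
    left-hand side and leaves \<open>k * k = d * ?b\<close>.\<close>
  also have "card ?A = (d - 1) * (k * k) + k * k"
    using card_ones[OF F] d by (cases d) (auto simp: algebra_simps)
  finally have "k * k = d * ?b" by simp
  then show ?thesis by simp
qed

end

theorem theorem2p4:
  fixes n d lam :: nat and S :: "nat mat set"
  assumes "n > 0" and "d > 1" and "d dvd n"
    and "lam = n div d"
    and "S = {cyclic_square d lam i | i. 0 \<le> i \<and> i \<le> d - 2}"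
  shows "card S = d - 1 \<and>
         (\<forall>F \<in> S. frequency_square n [n - lam, lam] F) \<and>
         mofs n S \<and>
         ((\<exists>p::nat. prime p \<and> p dvd d \<and> \<not> p dvd lam) \<longrightarrow> type_maximal n S)"
proof -
  have n: "n = d * lam" using assms by simp
  interpret cyclic_squares d lam
    using assms(1,2) n by unfold_locales auto
  \<comment> \<open>The bounds \<open>i \<le> d - 2\<close> and \<open>i < d - 1\<close> agree on
    natural numbers because \<open>d > 1\<close>.\<close>
  have S: "S = cyclic_square d lam ` {..<d - 1}"
    unfolding assms(5) using \<open>d > 1\<close> by (auto simp: image_iff)
  have card: "card S = d - 1"
    unfolding S using card_image[OF inj_on_cyclic_square] by simp
  have freq: "\<forall>F \<in> S. frequency_square n [n - lam, lam] F"
    unfolding S n using frequency_square_cyclic_square by blast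
  have mofs: "mofs n S"
    unfolding mofs_def using freq orthogonal_cyclic_squares by (auto simp: S n)
  have "type_maximal n S" if p: "prime p" "p dvd d" "\<not> p dvd lam" for p :: nat
    unfolding type_maximal_def
  proof (intro conjI mofs notI)
    assume "\<exists>F. (\<forall>G \<in> S. orthogonal_squares n F G) \<and>
      (\<exists>T \<in> S. \<exists>ls. frequency_square n ls T \<and> frequency_square n ls F)"
    then obtain F T ls where orth: "\<forall>G \<in> S. orthogonal_squares n F G" and "T \<in> S"
      and T: "frequency_square n ls T" and F: "frequency_square n ls F" by blast
    \<comment> \<open>Sharing a type with some member of \<open>S\<close> forces the common type of
      all the cyclic squares.\<close>
    have "ls = [n - lam, lam]"
      using frequency_square_type_unique[OF T] freq \<open>T \<in> S\<close> by blast
    then have "d dvd lam * lam"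
      using F orth by (intro orthogonal_cyclic_squares_imp_dvd) (auto simp: n S)
    then show False
      using p by (metis dvd_trans prime_dvd_mult_iff)
  qed
  then show ?thesis using card freq mofs by blast
qed

end
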